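(* Let $\rho_0(\cdot,\cdot)$ be the hyperbolic distance on the strip $\mathbb{S}_0=(-1,1)\times\mathbb{R}$. If $u_1,u_2\in(-1,1)$, then $$\rho_0(u_1,u_2)=\left|\ln\frac{s(u_2)}{s(u_1)}\right|.$$ Let $a\in(-1,1)$ and let $h$ be a real-valued harmonic function from the unit disk $\mathbb{U}$ into $(-1,1)$ with $h(0)=a$. Then $$X^-(|z|,a)\le h(z)\le X^+(|z|,a)\qquad\text{for all } z\in\mathbb{U},$$ and $$|(dh)_0|\le \frac{\partial X^+}{\partial r}(0,a)=\frac{4}{\pi}\sin\alpha(a).$$
   Context: $\mathbb{U}$ is the open unit disk in $\mathbb{C}$. The strip $\mathbb{S}_0=\{w\in\mathbb{C}:-1<\operatorname{Re}w<1\}$ carries the hyperbolic metric with density $\rho_0(w)=\frac{\pi}{2}\,\frac{1}{\cos(\frac{\pi}{2}\operatorname{Re}w)}$ (the normalization in which the density of $\mathbb{U}$ is $2/(1-|z|^2)$); the interval $(-1,1)$ is regarded as a subset of $\mathbb{S}_0$. For $a\in(-1,1)$ and $0\le r<1$ put $s(a)=\tan\big(\frac{\pi}{4}(a+1)\big)$, $e(a)=\cot\big(\frac{\pi}{4}(a+1)\big)$, $\alpha(a)=\frac{\pi}{2}(a+1)$, $$X^+(r,a)=\frac4\pi\arctan\Big(s(a)\frac{1+r}{1-r}\Big)-1,\qquad X^-(r,a)=1-\frac4\pi\arctan\Big(e(a)\frac{1+r}{1-r}\Big).$$ $|(dh)_0|$ is the norm of the differential of $h$ at $0$, i.e. $|\nabla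 h(0)|$. *)

theory Defs
  imports "HOL-Analysis.Analysis"
begin

definition strip :: "complex set" where
  "strip = {w. -1 < Re w \<and> Re w < 1}"

definition strip_density :: "complex \<Rightarrow> real" where
  "strip_density w = pi / 2 * (1 / cos (pi / 2 * Re w))"

(* Infimum of hyperbolic lengths over piecewise C1 paths in the strip.
   A valid path may have infinite length, because its derivative may be unbounded
   near the exceptional points.  The operator integral would assign such a path the
   junk length 0; using has_integral excludes it instead. *)
definition strip_dist :: "complex \<Rightarrow> complex \<Rightarrow> real" where
  "strip_dist p q = Inf {L. \<exists>\<gamma>. valid_path \<gamma> \<and> path_image \<gamma> \<subseteq> strip \<and>
     pathstart \<gamma> = p \<and> pathfinish \<gamma> = q \<and>
     ((\<lambda>t. strip_density (\<gamma> t) * norm (vector_derivative \<gamma> (at t within {0..1})))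
        has_integral L) {0..1}}"

(* h is C2 on the open set S with vanishing Laplacian; hx, hy are its first partial
   derivatives and hxx, hxy, hyx, hyy its second ones.  Continuity of hx and hy is
   implied by their differentiability. *)
definition harmonic_on :: "(complex \<Rightarrow> real) \<Rightarrow> complex set \<Rightarrow> bool" where
  "harmonic_on h S \<longleftrightarrow> open S \<and>
     (\<exists>hx hy hxx hxy hyx hyy.
        (\<forall>z\<in>S. (h has_derivative (\<lambda>v. hx z * Re v + hy z * Im v)) (at z) \<and>
               (hx has_derivative (\<lambda>v. hxx z * Re v + hxy z * Im v)) (at z) \<and>
               (hy has_derivative (\<lambda>v. hyx z * Re v + hyy z * Im v)) (at z) \<and>
               hxx z + hyy z = 0) \<and>
        continuous_on S hxx \<and> continuous_on S hxy \<and>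
        continuous_on S hyx \<and> continuous_on S hyy)"

definition s_fun :: "real \<Rightarrow> real" where
  "s_fun a = tan (pi / 4 * (a + 1))"

definition e_fun :: "real \<Rightarrow> real" where
  "e_fun a = cot (pi / 4 * (a + 1))"

definition alpha :: "real \<Rightarrow> real" where
  "alpha a = pi / 2 * (a + 1)"

definition X_plus :: "real \<Rightarrow> real \<Rightarrow> real" where
  "X_plus r a = 4 / pi * arctan (s_fun a * ((1 + r) / (1 - r))) - 1"

definition X_minus :: "real \<Rightarrow> real \<Rightarrow> real" where
  "X_minus r a = 1 - 4 / pi * arctan (e_fun a * ((1 + r) / (1 - r)))"

end

theory Submission
  imports Defs "HOL-Complex_Analysis.Complex_Analysis"
begin

text \<open>The hyperbolic metric of the strip is invariant under vertical translations, and
\<open>ln (s_fun x)\<close> is its arc length parameter on the real axis: its derivative is the density. Along an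
arbitrary path the integral of density times speed is at least the integral of density times
horizontal speed, which is the increment of \<open>ln (s_fun (Re w))\<close>; real segments attain equality. This
gives the distance formula.

A harmonic function \<open>h\<close> on the disk is the real part of a holomorphic \<open>f\<close>
(\<open>harmonic_on_imp_Re_holomorphic\<close>), and this \<open>f\<close> maps the disk into the strip. Both estimates are
instances of the Schwarz-Pick principle that \<open>f\<close> does not increase hyperbolic distances. The principle
is used in the upper half plane, to which \<open>Q = exp (\<i> (pi/2) (f + 1))\<close> maps the disk: there the
Cayley transform reduces it to the Schwarz lemma (\<open>Schwarz_Pick_upper_halfplane\<close>), and \<open>h\<close> is, up to
an affine change, the argument of \<open>Q\<close>. The vertical lines of the strip become rays, so bounding
\<open>h\<close> means asking which rays meet a hyperbolic disk (\<open>pseudo_hyperbolic_rays\<close>). The answer is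
\<open>(1 - r) / (1 + r) \<le> s_fun (h z) / s_fun a \<le> (1 + r) / (1 - r)\<close> with \<open>r = norm z\<close>,
and solving for \<open>h z\<close> produces \<open>X_minus\<close> and \<open>X_plus\<close>. The gradient bound is the infinitesimal form
of the same inequality, as \<open>|\<nabla>h(0)| = |f'(0)|\<close>.\<close>

section \<open>Hyperbolic distance on the real axis of the strip\<close>

lemma quarter_angle_bounds:
  assumes "x \<in> {-1<..<1::real}"
  shows "0 < pi / 4 * (x + 1)" and "pi / 4 * (x + 1) < pi / 2"
  using assms mult_strict_left_mono [of "x + 1" 2 "pi / 4"] by auto

lemma s_fun_pos:
  assumes "x \<in> {-1<..<1}"
  shows "0 < s_fun x"
  unfolding s_fun_def using quarter_angle_bounds [OF assms] by (intro tan_gt_zero)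

lemma strip_density_pos:
  assumes "w \<in> strip"
  shows "0 < strip_density w"
proof -
  have "\<bar>Re w\<bar> < 1"
    using assms by (auto simp: strip_def)
  then have "\<bar>pi / 2 * Re w\<bar> < pi / 2"
    by (simp add: abs_mult)
  then have "0 < cos (pi / 2 * Re w)"
    by (intro cos_gt_zero_pi) linarith+
  then show ?thesis
    by (simp add: strip_density_def)
qed

text \<open>The density of the strip depends on the real part alone, so on the real axis the metric has a
global arc length parameter; this lemma identifies it as \<open>ln \<circ> s_fun\<close>. The point \<open>w\<close> is
kept separate from its real part because the lemma is applied along paths that leave the axis.\<close>

lemma ln_s_fun_has_derivative:
  assumes "x \<in> {-1<..<1}" and "Re w = x"
  shows "((\<lambda>x. ln (s_fun x)) has_real_derivative strip_density w) (at x)"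
proof -
  define y where "y = pi / 4 * (x + 1)"
  have y: "0 < y" "y < pi / 2"
    using quarter_angle_bounds [OF assms(1)] by (auto simp: y_def)
  have tan_y: "0 < tan (pi / 4 * (x + 1))"
    using y tan_gt_zero by (simp add: y_def)
  have c: "0 < cos y" and s: "0 < sin y"
    using y by (auto intro!: cos_gt_zero sin_gt_zero)
  have d: "cos (pi / 2 * Re w) = 2 * sin y * cos y"
  proof -
    have "cos (pi / 2 * Re w) = sin (2 * y)"
      by (subst cos_sin_eq [of "pi/2 * Re w"], subst sin_pi_minus [symmetric])
        (auto simp: y_def assms algebra_simps intro!: arg_cong [of _ _ sin])
    then show ?thesis
      by (simp add: sin_double)
  qed
  have "((\<lambda>x. pi / 4 * (x + 1)) has_real_derivative pi / 4) (at x)"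
    by (auto intro!: derivative_eq_intros)
  moreover have "(tan has_real_derivative inverse ((cos y)\<^sup>2)) (at y)"
    using c by (intro DERIV_tan) simp
  ultimately have "((\<lambda>x. tan (pi / 4 * (x + 1))) has_real_derivative
      inverse ((cos y)\<^sup>2) * (pi / 4)) (at x)"
    unfolding y_def by (rule DERIV_chain2 [rotated])
  then have "((\<lambda>x. ln (tan (pi / 4 * (x + 1)))) has_real_derivative
      inverse (tan (pi / 4 * (x + 1))) * (inverse ((cos y)\<^sup>2) * (pi / 4))) (at x)"
    by (rule DERIV_chain2 [OF DERIV_ln, rotated]) (rule tan_y)
  also have "inverse (tan (pi / 4 * (x + 1))) * (inverse ((cos y)\<^sup>2) * (pi / 4)) = strip_density w"
    unfolding y_def [symmetric] strip_density_def d using c s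
    by (simp add: tan_def field_simps power2_eq_square)
  finally show ?thesis
    by (simp add: s_fun_def)
qed

text \<open>Along any path, the horizontal component of the velocity alone contributes an exact form, the
differential of \<open>ln (s_fun (Re w))\<close>. The fundamental theorem of calculus tolerates the finitely many
corners of a valid path, near which the derivative may even be unbounded.\<close>

lemma strip_path_integral_exact:
  assumes \<gamma>: "valid_path \<gamma>" and im: "path_image \<gamma> \<subseteq> strip"
  shows "((\<lambda>t. strip_density (\<gamma> t) * Re (vector_derivative \<gamma> (at t within {0..1})))
           has_integral (ln (s_fun (Re (pathfinish \<gamma>))) - ln (s_fun (Re (pathstart \<gamma>))))) {0..1}"
proof -
  obtain K where K: "finite K" "continuous_on {0..1} \<gamma>" "\<gamma> C1_differentiable_on ({0..1} - K)"
    using \<gamma> by (auto simp: valid_path_def piecewise_C1_differentiable_on_def)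
  have in_strip: "Re (\<gamma> t) \<in> {-1<..<1}" if "t \<in> {0..1}" for t
  proof -
    have "\<gamma> t \<in> strip"
      using im that by (auto simp: path_image_def)
    then show ?thesis
      by (simp add: strip_def)
  qed
  have G: "((\<lambda>x. ln (s_fun x)) has_real_derivative strip_density (\<gamma> t)) (at (Re (\<gamma> t)))"
    if "t \<in> {0..1}" for t
    by (rule ln_s_fun_has_derivative [OF in_strip [OF that] refl])
  have "((\<lambda>t. strip_density (\<gamma> t) * Re (vector_derivative \<gamma> (at t within {0..1})))
           has_integral ((\<lambda>t. ln (s_fun (Re (\<gamma> t)))) 1 - (\<lambda>t. ln (s_fun (Re (\<gamma> t)))) 0)) {0..1}"
  proof (rule fundamental_theorem_of_calculus_interior_strong [OF \<open>finite K\<close>])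
    fix t :: real assume t: "t \<in> {0<..<1} - K"
    then have "(\<gamma> has_vector_derivative vector_derivative \<gamma> (at t)) (at t)"
      using K(3) by (auto simp: C1_differentiable_on_eq vector_derivative_works)
    then have "((\<lambda>t. Re (\<gamma> t)) has_vector_derivative Re (vector_derivative \<gamma> (at t))) (at t)"
      by (rule bounded_linear.has_vector_derivative [OF bounded_linear_Re])
    moreover have "((\<lambda>x. ln (s_fun x)) has_real_derivative strip_density (\<gamma> t)) (at (Re (\<gamma> t)))"
      using G t by auto
    ultimately have "((\<lambda>t. ln (s_fun (Re (\<gamma> t)))) has_real_derivative
        strip_density (\<gamma> t) * Re (vector_derivative \<gamma> (at t))) (at t)"
      using DERIV_chain2 [of "\<lambda>x. ln (s_fun x)"]
      by (auto simp flip: has_real_derivative_iff_has_vector_derivative)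
    then show "((\<lambda>t. ln (s_fun (Re (\<gamma> t)))) has_vector_derivative
        strip_density (\<gamma> t) * Re (vector_derivative \<gamma> (at t within {0..1}))) (at t)"
      using t by (simp add: at_within_Icc_at has_real_derivative_iff_has_vector_derivative)
  next
    have "continuous_on {-1<..<1} (\<lambda>x. ln (s_fun x))"
      by (rule DERIV_continuous_on [where D = "\<lambda>x. strip_density (of_real x)"],
          rule has_field_derivative_at_within, rule ln_s_fun_has_derivative) auto
    then show "continuous_on {0..1} (\<lambda>t. ln (s_fun (Re (\<gamma> t))))"
      by (rule continuous_on_compose2) (use in_strip K(2) in \<open>auto intro!: continuous_intros\<close>)
  qed auto
  then show ?thesis
    by (simp add: pathfinish_def pathstart_def)
qed

text \<open>Replacing the speed by the absolute value of its horizontal component cannot increase the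
length, and this smaller length bounds the exact integral above in modulus.\<close>

lemma strip_length_ge:
  assumes "valid_path \<gamma>" "path_image \<gamma> \<subseteq> strip"
    and L: "((\<lambda>t. strip_density (\<gamma> t) * norm (vector_derivative \<gamma> (at t within {0..1})))
              has_integral L) {0..1}"
  shows "\<bar>ln (s_fun (Re (pathfinish \<gamma>))) - ln (s_fun (Re (pathstart \<gamma>)))\<bar> \<le> L"
proof -
  note E = strip_path_integral_exact [OF assms(1,2)]
  have pos: "0 < strip_density (\<gamma> t)" if "t \<in> {0..1}" for t
    using assms(2) that by (intro strip_density_pos) (auto simp: path_image_def)
  have le: "strip_density (\<gamma> t) * Re v \<le> strip_density (\<gamma> t) * norm v"
    "strip_density (\<gamma> t) * (- Re v) \<le> strip_density (\<gamma> t) * norm v" if "t \<in> {0..1}" for t v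
    by (rule mult_left_mono; use pos [OF that] abs_Re_le_cmod [of v] in linarith)+
  have "ln (s_fun (Re (pathfinish \<gamma>))) - ln (s_fun (Re (pathstart \<gamma>))) \<le> L"
    by (rule has_integral_le [OF E L le(1)])
  moreover have "- (ln (s_fun (Re (pathfinish \<gamma>))) - ln (s_fun (Re (pathstart \<gamma>)))) \<le> L"
    by (rule has_integral_le [OF has_integral_neg [OF E] L]) (use le(2) in simp)
  ultimately show ?thesis
    by linarith
qed

text \<open>The segment between two real points moves only horizontally and in one direction, so it attains
the lower bound for the length.\<close>

lemma strip_dist_real:
  assumes u: "u1 \<in> {-1<..<1}" "u2 \<in> {-1<..<1}"
  shows "strip_dist (complex_of_real u1) (complex_of_real u2) = \<bar>ln (s_fun u2 / s_fun u1)\<bar>"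
proof -
  define D where "D = ln (s_fun u2) - ln (s_fun u1)"
  define \<gamma> where "\<gamma> = linepath (complex_of_real u1) (complex_of_real u2)"
  have im: "path_image \<gamma> \<subseteq> strip"
  proof -
    have "convex strip"
      unfolding strip_def
      using convex_Int [OF convex_halfspace_Re_gt [of "-1"] convex_halfspace_Re_lt [of 1]]
      by (simp add: Int_def)
    then show ?thesis
      unfolding \<gamma>_def path_image_linepath using u
      by (intro closed_segment_subset) (auto simp: strip_def)
  qed
  have \<gamma>: "valid_path \<gamma>" "pathstart \<gamma> = of_real u1" "pathfinish \<gamma> = of_real u2"
    by (auto simp: \<gamma>_def)
  have vd: "vector_derivative \<gamma> (at t within {0..1}) = of_real (u2 - u1)" if "t \<in> {0..1}" for t
    unfolding \<gamma>_def using that by (subst vector_derivative_linepath_within) auto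
  have "((\<lambda>t. sgn (u2 - u1) * (strip_density (\<gamma> t) * Re (vector_derivative \<gamma> (at t within {0..1}))))
      has_integral (sgn (u2 - u1) * D)) {0..1}"
    using strip_path_integral_exact [OF \<gamma>(1) im]
    by (intro has_integral_mult_right) (simp add: D_def \<gamma>)
  then have L: "((\<lambda>t. strip_density (\<gamma> t) * norm (vector_derivative \<gamma> (at t within {0..1})))
      has_integral (sgn (u2 - u1) * D)) {0..1}"
    by (rule has_integral_eq [rotated])
      (simp add: vd abs_sgn algebra_simps norm_of_real del: of_real_diff)
  \<comment> \<open>The factor \<open>sgn (u2 - u1)\<close> cannot make the length exceed \<open>\<bar>D\<bar>\<close>, and the lower bound for
    all paths forbids anything smaller.\<close>
  have "\<bar>D\<bar> \<le> sgn (u2 - u1) * D"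
    using strip_length_ge [OF \<gamma>(1) im L] by (simp add: \<gamma> D_def)
  then have "sgn (u2 - u1) * D = \<bar>D\<bar>"
    by (auto simp: sgn_real_def split: if_splits)
  with L have L: "((\<lambda>t. strip_density (\<gamma> t) * norm (vector_derivative \<gamma> (at t within {0..1})))
      has_integral \<bar>D\<bar>) {0..1}"
    by simp
  have "strip_dist (complex_of_real u1) (complex_of_real u2) = \<bar>D\<bar>"
    unfolding strip_dist_def
  proof (rule cInf_eq_minimum, goal_cases)
    case 1
    show ?case using \<gamma> im L by blast
  next
    case (2 L)
    then obtain \<eta> where \<eta>: "valid_path \<eta>" "path_image \<eta> \<subseteq> strip"
        "pathstart \<eta> = of_real u1" "pathfinish \<eta> = of_real u2"
      and L: "((\<lambda>t. strip_density (\<eta> t) * norm (vector_derivative \<eta> (at t within {0..1})))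
        has_integral L) {0..1}"
      by blast
    show ?case
      using strip_length_ge [OF \<eta>(1,2) L] by (simp add: \<eta>(3,4) D_def)
  qed
  then show ?thesis
    using s_fun_pos [OF u(1)] s_fun_pos [OF u(2)] by (simp add: D_def ln_div)
qed

section \<open>Symmetry of the second derivative\<close>

text \<open>The mean value theorem in direction \<open>u\<close> turns the second difference into an increment of the
directional derivative \<open>f' _ u\<close>; differentiability of the latter at the single point \<open>z\<close> evaluates
this increment up to \<open>o(t)\<close>.\<close>

lemma second_difference_quotient:
  fixes f :: "'a::real_normed_vector \<Rightarrow> real"
  assumes S: "open S" "z \<in> S"
    and f': "\<And>x. x \<in> S \<Longrightarrow> (f has_derivative f' x) (at x)"
    and A: "((\<lambda>x. f' x u) has_derivative A) (at z)"
  shows "((\<lambda>t. (f (z + t *\<^sub>R u + t *\<^sub>R v) - f (z + t *\<^sub>R u) - f (z + t *\<^sub>R v) + f z) / t\<^sup>2)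
           \<longlongrightarrow> A v) (at_right 0)"
proof (rule tendstoI)
  fix e :: real assume e: "0 < e"
  define c where "c = e / (2 * norm u + norm v + 1)"
  have c: "0 < c" "c * (2 * norm u + norm v) < e"
    using e by (auto simp: c_def field_simps add_pos_nonneg intro!: divide_pos_pos)
  interpret A: bounded_linear A
    using A by (rule has_derivative_bounded_linear)
  obtain d1 where d1: "0 < d1" "\<And>w. norm (w - z) < d1 \<Longrightarrow>
      \<bar>f' w u - f' z u - A (w - z)\<bar> \<le> c * norm (w - z)"
    using A \<open>0 < c\<close> unfolding has_derivative_at_alt by fastforce
  obtain d2 where d2: "0 < d2" "ball z d2 \<subseteq> S"
    using S open_contains_ball by blast
  define d where "d = min d1 d2 / (norm u + norm v + 1)"
  have "0 < d"
    using d1 d2 by (auto simp: d_def intro!: divide_pos_pos add_nonneg_pos)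
  have "dist ((f (z + t *\<^sub>R u + t *\<^sub>R v) - f (z + t *\<^sub>R u) - f (z + t *\<^sub>R v) + f z) / t\<^sup>2) (A v) < e"
    if t: "0 < t" "t < d" for t
  proof -
    have near: "norm (s *\<^sub>R u + r *\<^sub>R v) < min d1 d2" if "0 \<le> s" "s \<le> t" "0 \<le> r" "r \<le> t" for r s
    proof -
      have "norm (s *\<^sub>R u + r *\<^sub>R v) \<le> s * norm u + r * norm v"
        using norm_triangle_ineq [of "s *\<^sub>R u" "r *\<^sub>R v"] that by simp
      also have "\<dots> \<le> t * norm u + t * norm v"
        using that by (intro add_mono mult_right_mono) auto
      also have "\<dots> \<le> t * (norm u + norm v + 1)"
        using t by (simp add: algebra_simps)
      also have "\<dots> < d * (norm u + norm v + 1)"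
        using t by (intro mult_strict_right_mono) (auto intro: add_nonneg_pos)
      also have "\<dots> = min d1 d2"
        by (simp add: d_def) (smt (verit) norm_ge_zero)
      finally show ?thesis .
    qed
    have inS: "z + s *\<^sub>R u + r *\<^sub>R v \<in> S" if "0 \<le> s" "s \<le> t" "0 \<le> r" "r \<le> t" for r s
    proof (rule subsetD [OF d2(2)])
      have "dist (z + s *\<^sub>R u + r *\<^sub>R v) z = norm (s *\<^sub>R u + r *\<^sub>R v)"
        unfolding dist_norm by (rule arg_cong [of _ _ norm]) simp
      then show "z + s *\<^sub>R u + r *\<^sub>R v \<in> ball z d2"
        using near [OF that] by (simp add: dist_commute)
    qed
    have der: "((\<lambda>s. f (z + s *\<^sub>R u + r *\<^sub>R v)) has_real_derivative f' (z + s *\<^sub>R u + r *\<^sub>R v) u) (at s)"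
      if "0 \<le> s" "s \<le> t" "0 \<le> r" "r \<le> t" for r s
    proof -
      have "((\<lambda>s. z + s *\<^sub>R u + r *\<^sub>R v) has_derivative (\<lambda>h. h *\<^sub>R u)) (at s)"
        by (auto intro!: derivative_eq_intros)
      from has_derivative_compose [OF this f' [OF inS [OF that]]]
      have "((\<lambda>s. f (z + s *\<^sub>R u + r *\<^sub>R v)) has_derivative (\<lambda>h. f' (z + s *\<^sub>R u + r *\<^sub>R v) (h *\<^sub>R u))) (at s)"
        by simp
      then show ?thesis
        using linear_scale [OF has_derivative_linear [OF f' [OF inS [OF that]]]]
        by (simp add: has_field_derivative_def mult_commute_abs)
    qed
    \<comment> \<open>The second difference is the increment of \<open>\<phi>\<close> between \<open>0\<close> and \<open>t\<close>.\<close>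
    define \<phi> where "\<phi> = (\<lambda>s. f (z + s *\<^sub>R u + t *\<^sub>R v) - f (z + s *\<^sub>R u))"
    have "\<exists>s. 0 < s \<and> s < t \<and> \<phi> t - \<phi> 0 = (t - 0) * (f' (z + s *\<^sub>R u + t *\<^sub>R v) u - f' (z + s *\<^sub>R u) u)"
    proof (rule MVT2 [OF \<open>0 < t\<close>])
      fix s :: real assume "0 \<le> s" "s \<le> t"
      then show "(\<phi> has_real_derivative
          f' (z + s *\<^sub>R u + t *\<^sub>R v) u - f' (z + s *\<^sub>R u) u) (at s)"
        unfolding \<phi>_def using der [of s t] der [of s 0] t by (intro DERIV_diff) simp_all
    qed
    then obtain s where s: "0 < s" "s < t"
      and \<phi>: "\<phi> t - \<phi> 0 = t * (f' (z + s *\<^sub>R u + t *\<^sub>R v) u - f' (z + s *\<^sub>R u) u)"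
      by auto
    define p where "p = f' (z + s *\<^sub>R u + t *\<^sub>R v) u"
    define q where "q = f' (z + s *\<^sub>R u) u"
    have 1: "\<bar>p - f' z u - A (s *\<^sub>R u + t *\<^sub>R v)\<bar> \<le> c * norm (s *\<^sub>R u + t *\<^sub>R v)"
      using d1(2) [of "z + s *\<^sub>R u + t *\<^sub>R v"] near [of s t] s t by (simp add: p_def add.assoc)
    have 2: "\<bar>q - f' z u - A (s *\<^sub>R u)\<bar> \<le> c * norm (s *\<^sub>R u)"
      using d1(2) [of "z + s *\<^sub>R u"] near [of s 0] s t by (simp add: q_def)
    have "norm (s *\<^sub>R u + t *\<^sub>R v) + norm (s *\<^sub>R u) \<le> s * norm u + t * norm v + s * norm u"
      using norm_triangle_ineq [of "s *\<^sub>R u" "t *\<^sub>R v"] s t by simp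
    also have "\<dots> \<le> t * (2 * norm u + norm v)"
      using mult_right_mono [of s t "norm u"] s by (simp add: algebra_simps)
    finally have 3: "c * norm (s *\<^sub>R u + t *\<^sub>R v) + c * norm (s *\<^sub>R u) \<le> c * (t * (2 * norm u + norm v))"
      using c by (simp flip: distrib_left)
    have "\<bar>(p - q) - t * A v\<bar> \<le> c * norm (s *\<^sub>R u + t *\<^sub>R v) + c * norm (s *\<^sub>R u)"
      using 1 2 by (simp add: A.add A.scaleR)
    also have "\<dots> \<le> t * (c * (2 * norm u + norm v))"
      using 3 by (simp add: mult.left_commute)
    also have "\<dots> < t * e"
      using c t by simp
    finally have "\<bar>(p - q) - t * A v\<bar> < t * e" .
    moreover have "(\<phi> t - \<phi> 0) / t\<^sup>2 - A v = ((p - q) - t * A v) / t"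
      unfolding \<phi> p_def [symmetric] q_def [symmetric] using t
      by (simp add: field_simps power2_eq_square)
    ultimately have "\<bar>(\<phi> t - \<phi> 0) / t\<^sup>2 - A v\<bar> < e"
      using t by (simp only: abs_divide) (simp add: pos_divide_less_eq mult.commute)
    moreover have "f (z + t *\<^sub>R u + t *\<^sub>R v) - f (z + t *\<^sub>R u) - f (z + t *\<^sub>R v) + f z = \<phi> t - \<phi> 0"
      by (simp add: \<phi>_def)
    ultimately show ?thesis
      by (simp only: dist_norm real_norm_def)
  qed
  then show "\<forall>\<^sub>F t in at_right 0. dist ((f (z + t *\<^sub>R u + t *\<^sub>R v) - f (z + t *\<^sub>R u)
      - f (z + t *\<^sub>R v) + f z) / t\<^sup>2) (A v) < e"
    unfolding eventually_at_right_field using \<open>0 < d\<close> by blast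
qed

text \<open>The second difference does not change when the two directions are exchanged, hence neither does
its limit.\<close>

lemma second_derivative_symmetric:
  fixes f :: "'a::real_normed_vector \<Rightarrow> real"
  assumes S: "open S" "z \<in> S"
    and f': "\<And>x. x \<in> S \<Longrightarrow> (f has_derivative f' x) (at x)"
    and A: "((\<lambda>x. f' x u) has_derivative A) (at z)"
    and B: "((\<lambda>x. f' x v) has_derivative B) (at z)"
  shows "A v = B u"
proof (rule tendsto_unique [OF trivial_limit_at_right_real])
  show "((\<lambda>t. (f (z + t *\<^sub>R u + t *\<^sub>R v) - f (z + t *\<^sub>R u) - f (z + t *\<^sub>R v) + f z) / t\<^sup>2)
           \<longlongrightarrow> A v) (at_right 0)"
    by (rule second_difference_quotient [OF S f' A])
  have swap: "f (z + t *\<^sub>R v + t *\<^sub>R u) - f (z + t *\<^sub>R v) - f (z + t *\<^sub>R u) + f z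
      = f (z + t *\<^sub>R u + t *\<^sub>R v) - f (z + t *\<^sub>R u) - f (z + t *\<^sub>R v) + f z" for t
  proof -
    have eq: "z + t *\<^sub>R v + t *\<^sub>R u = z + t *\<^sub>R u + t *\<^sub>R v"
      by (simp only: ac_simps)
    show ?thesis
      unfolding eq by linarith
  qed
  show "((\<lambda>t. (f (z + t *\<^sub>R u + t *\<^sub>R v) - f (z + t *\<^sub>R u) - f (z + t *\<^sub>R v) + f z) / t\<^sup>2)
           \<longlongrightarrow> B u) (at_right 0)"
    using second_difference_quotient [OF S f' B, of u] unfolding swap .
qed

section \<open>Harmonic functions as real parts\<close>

text \<open>The function \<open>hx - \<i> hy\<close> satisfies the Cauchy-Riemann equations: one of them is the Laplace equation,
the other one the symmetry of the mixed derivatives. Its primitive has a real part with the same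
gradient as \<open>h\<close>. The additive constant is chosen to make the value at \<open>z0\<close> real, which later places
the image of the origin on the unit circle.\<close>

lemma harmonic_on_imp_Re_holomorphic:
  assumes h: "harmonic_on h S" and S: "convex S" "z0 \<in> S"
  obtains f where "f holomorphic_on S" "\<And>z. z \<in> S \<Longrightarrow> h z = Re (f z)" "f z0 = of_real (h z0)"
proof -
  from h obtain hx hy hxx hxy hyx hyy where "open S" and
    H: "\<forall>z\<in>S. (h has_derivative (\<lambda>v. hx z * Re v + hy z * Im v)) (at z) \<and>
               (hx has_derivative (\<lambda>v. hxx z * Re v + hxy z * Im v)) (at z) \<and>
               (hy has_derivative (\<lambda>v. hyx z * Re v + hyy z * Im v)) (at z) \<and>
               hxx z + hyy z = 0"
    unfolding harmonic_on_def by (elim conjE exE) rule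
  note h' = H [rule_format, THEN conjunct1]
    and hx = H [rule_format, THEN conjunct2, THEN conjunct1]
    and hy = H [rule_format, THEN conjunct2, THEN conjunct2, THEN conjunct1]
    and lap = H [rule_format, THEN conjunct2, THEN conjunct2, THEN conjunct2]
  define g where "g = (\<lambda>z. Complex (hx z) (- hy z))"
  have "(g has_field_derivative Complex (hxx z) (- hyx z)) (at z)" if z: "z \<in> S" for z
  proof -
    have sym: "hxy z = hyx z"
      using second_derivative_symmetric [OF \<open>open S\<close> z h', where u = 1 and v = \<i> and
          A = "\<lambda>v. hxx z * Re v + hxy z * Im v" and B = "\<lambda>v. hyx z * Re v + hyy z * Im v"]
        hx [OF z] hy [OF z]
      by simp
    have hyy: "hyy z = - hxx z"
      using lap [OF z] by simp
    have "(g has_derivative (\<lambda>v. of_real (hxx z * Re v + hxy z * Im v)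
        - \<i> * of_real (hyx z * Re v + hyy z * Im v))) (at z)"
      unfolding g_def Complex_eq
      by (auto intro!: derivative_eq_intros hx [OF z] hy [OF z])
    moreover have "(\<lambda>v. of_real (hxx z * Re v + hxy z * Im v)
        - \<i> * of_real (hyx z * Re v + hyy z * Im v)) = (*) (Complex (hxx z) (- hyx z))"
      by (auto simp: fun_eq_iff complex_eq_iff sym hyy algebra_simps)
    ultimately show ?thesis
      by (simp add: has_field_derivative_def)
  qed
  then have "g holomorphic_on S"
    using \<open>open S\<close> by (auto simp: holomorphic_on_open)
  then obtain F where F: "\<And>z. z \<in> S \<Longrightarrow> (F has_field_derivative g z) (at z within S)"
    using holomorphic_convex_primitive' S \<open>open S\<close> by blast
  have "((\<lambda>z. h z - Re (F z)) has_derivative (\<lambda>v. 0)) (at z within S)" if z: "z \<in> S" for z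
  proof -
    have "((\<lambda>z. h z - Re (F z)) has_derivative
        (\<lambda>v. (hx z * Re v + hy z * Im v) - Re (g z * v))) (at z within S)"
      using F [OF z] has_derivative_at_withinI [OF h' [OF z]] unfolding has_field_derivative_def
      by (intro has_derivative_diff has_derivative_Re)
    then show ?thesis
      by (simp add: g_def)
  qed
  then have "\<exists>c. \<forall>z\<in>S. h z - Re (F z) = c"
    by (rule has_derivative_zero_constant [OF S(1)])
  then obtain c where c: "\<And>z. z \<in> S \<Longrightarrow> h z - Re (F z) = c"
    by blast
  define f where "f = (\<lambda>z. F z - F z0 + of_real (h z0))"
  show thesis
  proof
    have "F holomorphic_on S"
      using F unfolding holomorphic_on_def field_differentiable_def by blast
    then show "f holomorphic_on S"
      unfolding f_def by (intro holomorphic_intros)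
    show "h z = Re (f z)" if "z \<in> S" for z
      using c [OF that] c [OF S(2)] by (simp add: f_def)
    show "f z0 = of_real (h z0)"
      by (simp add: f_def)
  qed
qed

section \<open>Schwarz-Pick estimates\<close>

text \<open>The Cayley transform that sends \<open>Q 0\<close> to the origin maps the half plane into the unit disk, so this is
the Schwarz lemma for the composition \<open>M\<close>.\<close>

lemma Schwarz_Pick_upper_halfplane:
  assumes Q: "Q holomorphic_on ball 0 1" and Im: "\<And>z. norm z < 1 \<Longrightarrow> 0 < Im (Q z)"
    and z: "norm z < 1"
  shows "norm (Q z - Q 0) \<le> norm z * norm (Q z - cnj (Q 0))"
    and "norm (deriv Q 0) \<le> 2 * Im (Q 0)"
proof -
  define M where "M = (\<lambda>z. (Q z - Q 0) / (Q z - cnj (Q 0)))"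
  have Im0: "0 < Im (Q 0)"
    using Im [of 0] by simp
  have nz: "Q w - cnj (Q 0) \<noteq> 0" if "norm w < 1" for w
    using Im [OF that] Im0 by (auto simp: complex_eq_iff)
  have hol: "M holomorphic_on ball 0 1"
    unfolding M_def using nz by (intro holomorphic_intros Q) auto
  have "norm (M w) < 1" if "norm w < 1" for w
  proof -
    \<comment> \<open>The two squares differ by \<open>4 * Im (Q w) * Im (Q 0)\<close>.\<close>
    have "(norm (Q w - Q 0))\<^sup>2 < (norm (Q w - cnj (Q 0)))\<^sup>2"
      using mult_pos_pos [OF Im [OF that] Im0]
      unfolding cmod_power2 by (simp add: power2_eq_square algebra_simps)
    then have "norm (Q w - Q 0) < norm (Q w - cnj (Q 0))"
      by (rule power2_less_imp_less) simp
    then show ?thesis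
      by (simp add: M_def norm_divide divide_less_eq_1)
  qed
  moreover have "M 0 = 0"
    by (simp add: M_def)
  ultimately have S: "norm (M z) \<le> norm z" "norm (deriv M 0) \<le> 1"
    using Schwarz_Lemma [OF hol] z by auto
  show "norm (Q z - Q 0) \<le> norm z * norm (Q z - cnj (Q 0))"
    using S(1) nz [OF z] by (simp add: M_def norm_divide field_simps)
  have dQ: "(Q has_field_derivative deriv Q 0) (at 0)"
    using Q by (rule holomorphic_derivI) auto
  have "(M has_field_derivative deriv Q 0 / (Q 0 - cnj (Q 0))) (at 0)"
    unfolding M_def using nz [of 0]
      DERIV_divide [OF DERIV_diff [OF dQ DERIV_const [of "Q 0"]] DERIV_diff [OF dQ DERIV_const [of "cnj (Q 0)"]]]
    by simp
  then have "deriv M 0 = deriv Q 0 / (Q 0 - cnj (Q 0))"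
    by (rule DERIV_imp_deriv)
  moreover have "norm (Q 0 - cnj (Q 0)) = 2 * Im (Q 0)"
    using Im0 by (simp add: complex_diff_cnj norm_mult)
  ultimately show "norm (deriv Q 0) \<le> 2 * Im (Q 0)"
    using S(2) Im0 by (simp add: norm_divide field_simps)
qed

text \<open>Among all points of the ray of argument \<open>\<theta>\<close>, the one of modulus \<open>1\<close> is closest to \<open>cis \<alpha>\<close> in the
pseudo-hyperbolic distance of the upper half plane, and for that point the distance is
\<open>\<bar>sin (\<theta>/2 - \<alpha>/2)\<bar> / sin (\<theta>/2 + \<alpha>/2)\<close>. Thus a bound on the distance of points is a bound on their
arguments.\<close>

lemma pseudo_hyperbolic_rays:
  assumes r: "0 \<le> r" "r \<le> 1" and \<rho>: "0 < \<rho>"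
    and \<theta>: "0 < \<theta>" "\<theta> < pi" and \<alpha>: "0 < \<alpha>" "\<alpha> < pi"
    and le: "norm (rcis \<rho> \<theta> - cis \<alpha>) \<le> r * norm (rcis \<rho> \<theta> - cnj (cis \<alpha>))"
  shows "\<bar>sin (\<theta>/2 - \<alpha>/2)\<bar> \<le> r * sin (\<theta>/2 + \<alpha>/2)"
proof -
  \<comment> \<open>Used for \<open>\<beta> = \<alpha>\<close> and \<open>\<beta> = - \<alpha>\<close>: the radial term is common
    to both distances, and dropping it is what moves the point to modulus \<open>1\<close>.\<close>
  have N: "(norm (rcis \<rho> \<theta> - cis \<beta>))\<^sup>2 = (\<rho> - 1)\<^sup>2 + 4 * \<rho> * (sin (\<theta>/2 - \<beta>/2))\<^sup>2" for \<beta>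
  proof -
    have "(norm (rcis \<rho> \<theta> - cis \<beta>))\<^sup>2 =
        \<rho>\<^sup>2 * ((cos \<theta>)\<^sup>2 + (sin \<theta>)\<^sup>2) + ((cos \<beta>)\<^sup>2 + (sin \<beta>)\<^sup>2) - 2 * \<rho> * cos (\<theta> - \<beta>)"
      unfolding cmod_power2
      by (simp add: cos_diff power2_eq_square algebra_simps
          del: sin_cos_squared_add sin_cos_squared_add2 sin_cos_squared_add3)
    also have "cos (\<theta> - \<beta>) = 1 - 2 * (sin (\<theta>/2 - \<beta>/2))\<^sup>2"
      using cos_double_sin [of "\<theta>/2 - \<beta>/2"] by (simp add: algebra_simps)
    finally show ?thesis
      by (simp add: power2_eq_square algebra_simps)
  qed
  have "(norm (rcis \<rho> \<theta> - cis \<alpha>))\<^sup>2 \<le> (r * norm (rcis \<rho> \<theta> - cis (- \<alpha>)))\<^sup>2"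
    using le r by (intro power_mono) (auto simp: cis_cnj)
  then have "(\<rho> - 1)\<^sup>2 + 4 * \<rho> * (sin (\<theta>/2 - \<alpha>/2))\<^sup>2
      \<le> r\<^sup>2 * (\<rho> - 1)\<^sup>2 + 4 * \<rho> * (r * sin (\<theta>/2 + \<alpha>/2))\<^sup>2"
    unfolding power_mult_distrib N by (simp add: algebra_simps)
  moreover have "r\<^sup>2 * (\<rho> - 1)\<^sup>2 \<le> 1 * (\<rho> - 1)\<^sup>2"
    using r by (intro mult_right_mono) (auto simp: power_le_one)
  ultimately have "4 * \<rho> * (sin (\<theta>/2 - \<alpha>/2))\<^sup>2 \<le> 4 * \<rho> * (r * sin (\<theta>/2 + \<alpha>/2))\<^sup>2"
    by linarith
  then have "(sin (\<theta>/2 - \<alpha>/2))\<^sup>2 \<le> (r * sin (\<theta>/2 + \<alpha>/2))\<^sup>2"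
    using \<rho> by simp
  moreover have "0 \<le> r * sin (\<theta>/2 + \<alpha>/2)"
    using r \<theta> \<alpha> by (intro mult_nonneg_nonneg sin_ge_zero) auto
  ultimately show ?thesis
    by (metis abs_of_nonneg abs_le_square_iff)
qed

text \<open>The exponential \<open>Q\<close> opens the strip to the upper half plane and turns the real part of \<open>f\<close> into the
argument of \<open>Q\<close>, namely \<open>alpha (Re f)\<close>. The Schwarz-Pick inequality then confines this argument. Half
of it has tangent \<open>s_fun (Re f)\<close>, which is where the function \<open>s_fun\<close> comes from.\<close>

lemma holomorphic_strip_bounds:
  assumes f: "f holomorphic_on ball 0 1" and f0: "f 0 = of_real a"
    and Re: "\<And>z. norm z < 1 \<Longrightarrow> Re (f z) \<in> {-1<..<1}" and z: "norm z < 1"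
  shows "Re (f z) \<le> 4 / pi * arctan (s_fun a * ((1 + norm z) / (1 - norm z))) - 1"
    and "norm (deriv f 0) \<le> 4 / pi * sin (alpha a)"
proof -
  define Q where "Q = (\<lambda>z. exp (\<i> * (pi / 2) * (f z + 1)))"
  have al: "alpha x \<in> {0<..<pi}" if "x \<in> {-1<..<1}" for x
    using quarter_angle_bounds [OF that] by (auto simp: alpha_def)
  have Q_polar: "Q w = rcis (exp (- (pi / 2 * Im (f w)))) (alpha (Re (f w)))" for w
    unfolding Q_def alpha_def
    by (simp add: exp_eq_polar rcis_def algebra_simps)
  have Q0: "Q 0 = cis (alpha a)"
    using Q_polar [of 0] by (simp add: f0 rcis_def)
  have hol: "Q holomorphic_on ball 0 1"
    unfolding Q_def by (intro holomorphic_intros f)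
  have Im: "0 < Im (Q w)" if "norm w < 1" for w
    using al [OF Re [OF that]] by (auto simp: Q_polar intro!: mult_pos_pos sin_gt_zero)
  note SP = Schwarz_Pick_upper_halfplane [OF hol Im z]
  define r where "r = norm z"
  have r: "0 \<le> r" "r < 1"
    using z by (auto simp: r_def)
  have a: "a \<in> {-1<..<1}"
    using Re [of 0] by (simp add: f0)
  define x where "x = Re (f z)"
  have x: "x \<in> {-1<..<1}"
    using Re [OF z] by (simp add: x_def)
  define A where "A = alpha a / 2"
  define T where "T = alpha x / 2"
  have AT: "0 < A" "A < pi/2" "0 < T" "T < pi/2"
    using al [OF a] al [OF x] by (auto simp: A_def T_def)
  have "norm (rcis (exp (- (pi / 2 * Im (f z)))) (alpha x) - cis (alpha a))
      \<le> r * norm (rcis (exp (- (pi / 2 * Im (f z)))) (alpha x) - cnj (cis (alpha a)))"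
    using SP(1) unfolding Q0 Q_polar [of z] r_def x_def .
  then have "\<bar>sin (T - A)\<bar> \<le> r * sin (T + A)"
    unfolding A_def T_def
    by (rule pseudo_hyperbolic_rays [rotated -1]) (use r al [OF a] al [OF x] in auto)
  then have "sin T * cos A - cos T * sin A \<le> r * (sin T * cos A + cos T * sin A)"
    by (simp add: sin_diff sin_add)
  \<comment> \<open>After division by \<open>cos T * cos A\<close> this reads \<open>tan T * (1 - r) \<le> tan A * (1 + r)\<close>.\<close>
  then have "sin T * cos A * (1 - r) \<le> cos T * sin A * (1 + r)"
    by (simp add: algebra_simps)
  moreover have "0 < cos A" "0 < cos T"
    using AT by (auto intro!: cos_gt_zero)
  ultimately have "tan T \<le> tan A * ((1 + r) / (1 - r))"
    using r by (simp add: tan_def field_simps)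
  then have "arctan (tan T) \<le> arctan (tan A * ((1 + r) / (1 - r)))"
    by (rule arctan_monotone')
  moreover have "arctan (tan T) = T"
    using AT by (intro arctan_tan) auto
  moreover have "tan A = s_fun a" "x = 4 / pi * T - 1"
    by (auto simp: A_def T_def s_fun_def alpha_def field_simps)
  ultimately show "Re (f z) \<le> 4 / pi * arctan (s_fun a * ((1 + norm z) / (1 - norm z))) - 1"
    by (simp add: x_def r_def mult_left_mono divide_right_mono)
  have df: "(f has_field_derivative deriv f 0) (at 0)"
    using f by (rule holomorphic_derivI) auto
  have "(Q has_field_derivative Q 0 * (\<i> * (pi / 2) * deriv f 0)) (at 0)"
    unfolding Q_def by (auto intro!: derivative_eq_intros df)
  then have dQ: "deriv Q 0 = Q 0 * (\<i> * (pi / 2) * deriv f 0)"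
    by (rule DERIV_imp_deriv)
  have "norm (deriv Q 0) = pi / 2 * norm (deriv f 0)"
    unfolding dQ Q0 norm_mult by (simp add: norm_divide)
  then show "norm (deriv f 0) \<le> 4 / pi * sin (alpha a)"
    using SP(2) by (simp add: Q0 field_simps)
qed

section \<open>The extremal function and the gradient\<close>

text \<open>Since \<open>s_fun a\<close> is the tangent of \<open>alpha a / 2\<close>, the chain rule gives \<open>4/pi\<close> times
\<open>2 tan y / (1 + tan\<^sup>2 y)\<close> with \<open>y = alpha a / 2\<close>, and this fraction is the sine of the double angle.\<close>

lemma X_plus_has_derivative_at_0:
  assumes "a \<in> {-1<..<1}"
  shows "((\<lambda>r. X_plus r a) has_real_derivative 4 / pi * sin (alpha a)) (at 0)"
proof -
  define y where "y = pi / 4 * (a + 1)"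
  have c: "0 < cos y"
    using quarter_angle_bounds [OF assms] by (intro cos_gt_zero) (auto simp: y_def)
  have al: "alpha a = 2 * y"
    by (simp add: alpha_def y_def)
  have "((\<lambda>r. X_plus r a) has_real_derivative 4 / pi * (inverse (1 + (s_fun a)\<^sup>2) * (s_fun a * 2))) (at 0)"
    unfolding X_plus_def by (rule derivative_eq_intros refl | simp)+
  moreover have "inverse (1 + (s_fun a)\<^sup>2) * (s_fun a * 2) = sin (alpha a)"
  proof -
    have "1 + (tan y)\<^sup>2 = inverse ((cos y)\<^sup>2)"
      using c by (simp add: tan_sec power_inverse)
    then show ?thesis
      using c unfolding al sin_double s_fun_def y_def [symmetric]
      by (simp only: inverse_inverse_eq) (simp add: tan_def power2_eq_square)
  qed
  ultimately show ?thesis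
    by simp
qed

text \<open>Because of this reflection, \<open>X_minus r a = - X_plus r (- a)\<close>, and the lower bound for a function
is the upper bound for its negative.\<close>

lemma s_fun_minus: "s_fun (- a) = e_fun a"
proof -
  have "s_fun (- a) = tan (pi / 2 - pi / 4 * (a + 1))"
    unfolding s_fun_def by (rule arg_cong [of _ _ tan]) (simp add: field_simps)
  then show ?thesis
    by (simp add: e_fun_def tan_def cot_def sin_diff cos_diff)
qed

lemma frechet_derivative_Re_holomorphic:
  assumes S: "open S" "z \<in> S" and f: "f holomorphic_on S"
    and h: "\<And>w. w \<in> S \<Longrightarrow> h w = Re (f w)"
  shows "frechet_derivative h (at z) = (\<lambda>v. Re (deriv f z * v))"
proof -
  have "(f has_derivative (*) (deriv f z)) (at z)"
    using holomorphic_derivI [OF f S] by (simp add: has_field_derivative_def)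
  then have "((\<lambda>w. Re (f w)) has_derivative (\<lambda>v. Re (deriv f z * v))) (at z)"
    by (rule has_derivative_Re)
  then have "(h has_derivative (\<lambda>v. Re (deriv f z * v))) (at z)"
    by (rule has_derivative_transform_within_open [OF _ S]) (simp add: h)
  then show ?thesis
    by (rule frechet_derivative_at [symmetric])
qed

lemma onorm_Re_mult_le: "onorm (\<lambda>v. Re (c * v)) \<le> norm c"
proof (rule onorm_bound)
  show "norm (Re (c * v)) \<le> norm c * norm v" for v
    using abs_Re_le_cmod [of "c * v"] by (simp add: norm_mult)
qed simp

section \<open>Distance formula and bounds for harmonic functions\<close>

theorem theorem1:
  shows "(\<forall>u1\<in>{-1<..<1::real}. \<forall>u2\<in>{-1<..<1::real}.
            strip_dist (complex_of_real u1) (complex_of_real u2) = \<bar>ln (s_fun u2 / s_fun u1)\<bar>)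
       \<and> (\<forall>a\<in>{-1<..<1::real}. \<forall>h :: complex \<Rightarrow> real.
            harmonic_on h (ball 0 1) \<longrightarrow> h ` ball 0 1 \<subseteq> {-1<..<1} \<longrightarrow> h 0 = a \<longrightarrow>
              (\<forall>z\<in>ball 0 1. X_minus (norm z) a \<le> h z \<and> h z \<le> X_plus (norm z) a)
            \<and> (\<lambda>r. X_plus r a) differentiable (at 0 within {0..<1})
            \<and> onorm (frechet_derivative h (at 0))
                \<le> vector_derivative (\<lambda>r. X_plus r a) (at 0 within {0..<1})
            \<and> vector_derivative (\<lambda>r. X_plus r a) (at 0 within {0..<1})
                = 4 / pi * sin (alpha a))"
proof (intro conjI ballI allI impI)
  fix u1 u2 :: real assume "u1 \<in> {-1<..<1}" "u2 \<in> {-1<..<1}"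
  then show "strip_dist (complex_of_real u1) (complex_of_real u2) = \<bar>ln (s_fun u2 / s_fun u1)\<bar>"
    by (rule strip_dist_real)
next
  fix a :: real and h :: "complex \<Rightarrow> real"
  assume a: "a \<in> {-1<..<1}" and harm: "harmonic_on h (ball 0 1)"
    and ran: "h ` ball 0 1 \<subseteq> {-1<..<1}" and h0: "h 0 = a"
  obtain f where f: "f holomorphic_on ball 0 1" and hf: "\<And>z. z \<in> ball 0 1 \<Longrightarrow> h z = Re (f z)"
    and f0: "f 0 = of_real a"
    using harmonic_on_imp_Re_holomorphic [OF harm convex_ball, of 0] by (auto simp: h0)
  have Re: "Re (f z) \<in> {-1<..<1}" if "norm z < 1" for z
    using ran that hf [of z] by force
  have X_deriv: "((\<lambda>r. X_plus r a) has_vector_derivative 4 / pi * sin (alpha a)) (at 0 within {0..<1})"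
    using X_plus_has_derivative_at_0 [OF a]
    by (simp add: has_real_derivative_iff_has_vector_derivative has_vector_derivative_at_within)
  show "(\<lambda>r. X_plus r a) differentiable (at 0 within {0..<1})"
    using X_deriv by (rule differentiableI_vector)
  have "at (0::real) within {0..<1} \<noteq> bot"
    by (simp add: trivial_limit_within)
  then show X_vd: "vector_derivative (\<lambda>r. X_plus r a) (at 0 within {0..<1}) = 4 / pi * sin (alpha a)"
    using X_deriv by (rule vector_derivative_within)
  have "onorm (frechet_derivative h (at 0)) \<le> norm (deriv f 0)"
    using frechet_derivative_Re_holomorphic [OF open_ball _ f hf, of 0] onorm_Re_mult_le by simp
  also have "\<dots> \<le> 4 / pi * sin (alpha a)"
    by (rule holomorphic_strip_bounds(2) [OF f f0 Re, of 0]) auto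
  finally show "onorm (frechet_derivative h (at 0))
      \<le> vector_derivative (\<lambda>r. X_plus r a) (at 0 within {0..<1})"
    by (simp add: X_vd)
  fix z :: complex assume z: "z \<in> ball 0 1"
  show "h z \<le> X_plus (norm z) a"
    using holomorphic_strip_bounds(1) [OF f f0 Re, of z] z by (simp add: X_plus_def hf)
  have "(\<lambda>z. - f z) holomorphic_on ball 0 1"
    by (intro holomorphic_intros f)
  then have "Re (- f z) \<le> 4 / pi * arctan (s_fun (- a) * ((1 + norm z) / (1 - norm z))) - 1"
    by (rule holomorphic_strip_bounds(1)) (use f0 Re z in force)+
  then show "X_minus (norm z) a \<le> h z"
    using z by (simp add: X_minus_def s_fun_minus hf)
qed

end
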